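(* Any quantum algorithm that computes the longest square substring of a string of length $n$ (i.e. the maximum shift $\Delta$ such that $s[i..i+\Delta)=s[i+\Delta..i+2\Delta)$ for some $i\in[1..n-2\Delta+1]$) requires $\Omega(\sqrt n)$ queries.
   Context: Strings are 1-indexed sequences over an integer alphabet; $s[i..j)=s[i]\cdots s[j-1]$. Quantum query model: the input string $s$ is accessed through a unitary oracle $O_s:|i,b\rangle\mapsto|i,b\oplus s[i]\rangle$ ($\oplus$ is XOR of binary encodings of characters), which can be queried in superposition; between queries the algorithm may apply arbitrary unitaries independent of the input; it must output the correct answer with probability at least $2/3$. Query complexity is the number of oracle calls. *)

theory Defs
  imports Complex_Main
begin

section \<open>Strings and squares\<close>

text \<open>
  A string over an integer alphabet is a list of naturals; positions are 1-based, so
  \<open>substring s i j\<close> is \<open>s[i..j)\<close>.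
\<close>

definition char_at :: "nat list \<Rightarrow> nat \<Rightarrow> nat" where
  "char_at s i = s ! (i - 1)"

definition substring :: "nat list \<Rightarrow> nat \<Rightarrow> nat \<Rightarrow> nat list" where
  "substring s i j = map (char_at s) [i..<j]"

text \<open>
  The range of \<open>i\<close> is \<open>1 \<le> i \<le> n - 2\<Delta> + 1\<close>, written without subtraction because
  subtraction on naturals truncates. The shift \<open>0\<close> (empty square) is always admitted, hence
  \<open>longest_square s = 0\<close> for a square-free \<open>s\<close>.
\<close>

definition square_shifts :: "nat list \<Rightarrow> nat set" where
  "square_shifts s =
     {\<Delta>. \<exists>i. 1 \<le> i \<and> i + 2 * \<Delta> \<le> length s + 1 \<and>
            substring s i (i + \<Delta>) = substring s (i + \<Delta>) (i + 2 * \<Delta>)}"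

definition longest_square :: "nat list \<Rightarrow> nat" where
  "longest_square s = Max (square_shifts s)"

lemma finite_square_shifts: "finite (square_shifts s)"
proof (rule finite_subset)
  show "square_shifts s \<subseteq> {..length s}"
    by (auto simp: square_shifts_def)
qed simp

lemma zero_in_square_shifts: "0 \<in> square_shifts s"
  by (auto simp: square_shifts_def substring_def intro!: exI[of _ 1])


section \<open>Operators on a finite computational basis\<close>

text \<open>
  A vector of the space spanned by a finite set \<open>B\<close> of basis labels is given by its amplitudes,
  an operator by its matrix entries (row, column). Values outside \<open>B\<close> are irrelevant.
\<close>

type_synonym 'l amplitudes = "'l \<Rightarrow> complex"
type_synonym 'l operator = "'l \<Rightarrow> 'l \<Rightarrow> complex"

definition apply_op :: "'l set \<Rightarrow> 'l operator \<Rightarrow> 'l amplitudes \<Rightarrow> 'l amplitudes" where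
  "apply_op B U \<psi> x = (\<Sum>y\<in>B. U x y * \<psi> y)"

definition unitary_on :: "'l set \<Rightarrow> 'l operator \<Rightarrow> bool" where
  "unitary_on B U \<longleftrightarrow>
     (\<forall>x\<in>B. \<forall>y\<in>B. (\<Sum>z\<in>B. cnj (U z x) * U z y) = (if x = y then 1 else 0)) \<and>
     (\<forall>x\<in>B. \<forall>y\<in>B. (\<Sum>z\<in>B. U x z * cnj (U y z)) = (if x = y then 1 else 0))"


section \<open>Quantum query algorithms\<close>

text \<open>
  A label \<open>(i, c, z)\<close> stands for the basis state with the position \<open>i\<close> in the index register, the
  \<open>b\<close>-bit character code \<open>c\<close> in the character register and \<open>z\<close> in a workspace of dimension \<open>w\<close>.
\<close>

type_synonym label = "nat \<times> nat \<times> nat"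

definition labels :: "nat \<Rightarrow> nat \<Rightarrow> nat \<Rightarrow> label set" where
  "labels n b w = {1..n} \<times> {0..<2 ^ b} \<times> {0..<w}"

definition oracle_label :: "nat list \<Rightarrow> label \<Rightarrow> label" where
  "oracle_label s = (\<lambda>(i, c, z). (i, xor c (char_at s i), z))"

definition oracle_op :: "nat list \<Rightarrow> label operator" where
  "oracle_op s x y = (if x = oracle_label s y then 1 else 0)"

text \<open>
  The algorithm makes exactly \<open>queries A\<close> queries: it applies \<open>gate A 0\<close> to the basis state
  \<open>(1, 0, 0)\<close> and then alternates \<open>oracle_op s\<close> with \<open>gate A 1\<close>, \<dots>, \<open>gate A (queries A)\<close>.
  Finally the computational basis is measured and \<open>answer A\<close> is evaluated on the observed label.
\<close>

record query_algorithm =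
  char_bits :: nat
  work_dim :: nat
  queries :: nat
  gate :: "nat \<Rightarrow> label operator"
  answer :: "label \<Rightarrow> nat"

definition alg_labels :: "nat \<Rightarrow> query_algorithm \<Rightarrow> label set" where
  "alg_labels n A = labels n (char_bits A) (work_dim A)"

definition valid_algorithm :: "nat \<Rightarrow> nat set \<Rightarrow> query_algorithm \<Rightarrow> bool" where
  "valid_algorithm n alphabet A \<longleftrightarrow>
     work_dim A \<ge> 1 \<and>
     alphabet \<subseteq> {0..<2 ^ char_bits A} \<and>
     (\<forall>k\<le>queries A. unitary_on (alg_labels n A) (gate A k))"

primrec state_after :: "nat \<Rightarrow> query_algorithm \<Rightarrow> nat list \<Rightarrow> nat \<Rightarrow> label amplitudes" where
  "state_after n A s 0 =
     apply_op (alg_labels n A) (gate A 0) (\<lambda>x. if x = (1, 0, 0) then 1 else 0)"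
| "state_after n A s (Suc k) =
     apply_op (alg_labels n A) (gate A (Suc k))
       (apply_op (alg_labels n A) (oracle_op s) (state_after n A s k))"

definition output_prob :: "nat \<Rightarrow> query_algorithm \<Rightarrow> nat list \<Rightarrow> nat \<Rightarrow> real" where
  "output_prob n A s v =
     (\<Sum>x\<in>{x \<in> alg_labels n A. answer A x = v}. (cmod (state_after n A s (queries A) x))\<^sup>2)"

definition quantum_computes ::
    "nat \<Rightarrow> nat set \<Rightarrow> query_algorithm \<Rightarrow> (nat list \<Rightarrow> nat) \<Rightarrow> bool" where
  "quantum_computes n alphabet A f \<longleftrightarrow>
     valid_algorithm n alphabet A \<and>
     (\<forall>s. length s = n \<and> set s \<subseteq> alphabet \<longrightarrow> output_prob n A s (f s) \<ge> 2 / 3)"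

text \<open>Admissible inputs give unitary query operators.\<close>

lemma xor_less_two_power:
  fixes a c :: nat
  assumes "a < 2 ^ b" "c < 2 ^ b"
  shows "xor a c < 2 ^ b"
proof -
  have "take_bit b (xor a c) = xor a c"
    using assms by (simp add: take_bit_xor take_bit_nat_eq_self)
  then show ?thesis
    by (metis take_bit_nat_less_exp)
qed

lemma oracle_label_involution: "oracle_label s (oracle_label s x) = x"
  by (cases x) (simp add: oracle_label_def xor.assoc)

lemma oracle_label_in_labels:
  assumes "length s = n" "set s \<subseteq> {0..<2 ^ b}" "x \<in> labels n b w"
  shows "oracle_label s x \<in> labels n b w"
proof (cases x)
  case (fields i c z)
  then have i: "1 \<le> i" "i \<le> n" and c: "c < 2 ^ b" and z: "z < w"
    using assms(3) by (auto simp: labels_def)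
  have "char_at s i \<in> set s"
    using i assms(1) by (auto simp: char_at_def)
  then have "char_at s i < 2 ^ b"
    using assms(2) by auto
  then show ?thesis
    using fields i c z by (simp add: oracle_label_def labels_def xor_less_two_power)
qed

lemma unitary_on_oracle_op:
  assumes "length s = n" "set s \<subseteq> {0..<2 ^ b}"
  shows "unitary_on (labels n b w) (oracle_op s)"
proof -
  let ?B = "labels n b w"
  have fin: "finite ?B"
    by (simp add: labels_def)
  have inj: "oracle_label s x = oracle_label s y \<longleftrightarrow> x = y" for x y
    by (metis oracle_label_involution)
  have flip: "x = oracle_label s y \<longleftrightarrow> y = oracle_label s x" for x y
    by (metis oracle_label_involution)
  have mem: "oracle_label s x \<in> ?B" if "x \<in> ?B" for x
    using oracle_label_in_labels[OF assms that] .
  have 1: "(\<Sum>z\<in>?B. cnj (oracle_op s z x) * oracle_op s z y) = (if x = y then 1 else 0)"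
    if "x \<in> ?B" "y \<in> ?B" for x y
  proof -
    have "(\<Sum>z\<in>?B. cnj (oracle_op s z x) * oracle_op s z y) =
          (\<Sum>z\<in>?B. if z = oracle_label s x then (if x = y then 1 else 0) else 0)"
      by (rule sum.cong) (auto simp: oracle_op_def inj)
    then show ?thesis
      using fin mem that by simp
  qed
  have 2: "(\<Sum>z\<in>?B. oracle_op s x z * cnj (oracle_op s y z)) = (if x = y then 1 else 0)"
    if "x \<in> ?B" "y \<in> ?B" for x y
  proof -
    have "oracle_op s x z * cnj (oracle_op s y z) = cnj (oracle_op s z x) * oracle_op s z y" for z
      by (auto simp: oracle_op_def flip[of x z] flip[of y z])
    then show ?thesis
      using 1[OF that] by simp
  qed
  show ?thesis
    using 1 2 by (simp add: unitary_on_def)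
qed

end

theory Submission
  imports Defs "HOL-Analysis.L2_Norm"
begin

text \<open>
  For \<open>m = n div 2\<close>, the constant string \<open>a\<^sup>n\<close> contains a square of shift \<open>m\<close>. Such a square covers
  all positions except possibly the first or the last one, so replacing \<open>a\<close> by \<open>b\<close> at a single
  position \<open>1 < j < n\<close> destroys every square of shift \<open>m\<close>. The algorithm must therefore tell \<open>a\<^sup>n\<close>
  from each of these \<open>n - 2\<close> strings. By the hybrid argument, one query moves the final states for
  \<open>a\<^sup>n\<close> and for the \<open>j\<close>-th string apart by at most twice the norm of the part of the state which
  queries position \<open>j\<close>; the \<open>\<ell>\<^sup>2\<close>-norm over \<open>j\<close> of these bounds is at most \<open>2\<close>. After \<open>T\<close> queries the
  distances thus have \<open>\<ell>\<^sup>2\<close>-norm at most \<open>2 T\<close>, whereas correctness forces each one to be at least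
  \<open>1/5\<close>.
\<close>

section \<open>Norms of amplitude vectors\<close>

definition amp_norm :: "'l set \<Rightarrow> 'l amplitudes \<Rightarrow> real" where
  "amp_norm B \<psi> = L2_set (\<lambda>x. cmod (\<psi> x)) B"

lemma amp_norm_power2: "(amp_norm B \<psi>)\<^sup>2 = (\<Sum>x\<in>B. (cmod (\<psi> x))\<^sup>2)"
  by (simp add: amp_norm_def L2_set_def sum_nonneg)

lemma amp_norm_nonneg: "0 \<le> amp_norm B \<psi>"
  by (simp add: amp_norm_def L2_set_nonneg)

lemma amp_norm_cong: "(\<And>x. x \<in> B \<Longrightarrow> \<psi> x = \<phi> x) \<Longrightarrow> amp_norm B \<psi> = amp_norm B \<phi>"
  by (simp add: amp_norm_def L2_set_def)

lemma amp_norm_mono: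
  assumes "finite B" "C \<subseteq> B"
  shows "amp_norm C \<psi> \<le> amp_norm B \<psi>"
  using assms by (auto simp: amp_norm_def L2_set_def intro!: sum_mono2)

lemma amp_norm_triangle:
  assumes "\<And>x. x \<in> B \<Longrightarrow> cmod (\<chi> x) \<le> cmod (\<psi> x) + cmod (\<phi> x)"
  shows "amp_norm B \<chi> \<le> amp_norm B \<psi> + amp_norm B \<phi>"
proof -
  have "amp_norm B \<chi> \<le> L2_set (\<lambda>x. cmod (\<psi> x) + cmod (\<phi> x)) B"
    unfolding amp_norm_def using assms by (intro L2_set_mono) auto
  also have "\<dots> \<le> amp_norm B \<psi> + amp_norm B \<phi>"
    unfolding amp_norm_def by (rule L2_set_triangle_ineq)
  finally show ?thesis .
qed

text \<open>Expanding each squared modulus as \<open>z * cnj z\<close> and summing over the row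
  index first leaves inner products of columns of \<open>U\<close>, which are orthonormal.\<close>

lemma amp_norm_apply_unitary:
  assumes "finite B" "unitary_on B U"
  shows "amp_norm B (apply_op B U \<psi>) = amp_norm B \<psi>"
proof -
  have "complex_of_real (\<Sum>x\<in>B. (cmod (apply_op B U \<psi> x))\<^sup>2)
      = (\<Sum>x\<in>B. (\<Sum>y\<in>B. U x y * \<psi> y) * (\<Sum>z\<in>B. cnj (U x z) * cnj (\<psi> z)))"
    by (simp only: of_real_sum complex_norm_square apply_op_def cnj_sum complex_cnj_mult)
  also have "\<dots> = (\<Sum>x\<in>B. \<Sum>y\<in>B. \<Sum>z\<in>B. (cnj (U x z) * U x y) * (\<psi> y * cnj (\<psi> z)))"
    by (simp add: sum_product mult_ac)
  also have "\<dots> = (\<Sum>y\<in>B. \<Sum>x\<in>B. \<Sum>z\<in>B. (cnj (U x z) * U x y) * (\<psi> y * cnj (\<psi> z)))"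
    by (rule sum.swap)
  also have "\<dots> = (\<Sum>y\<in>B. \<Sum>z\<in>B. \<Sum>x\<in>B. (cnj (U x z) * U x y) * (\<psi> y * cnj (\<psi> z)))"
    by (intro sum.cong refl sum.swap)
  also have "\<dots> = (\<Sum>y\<in>B. \<Sum>z\<in>B. (if z = y then 1 else 0) * (\<psi> y * cnj (\<psi> z)))"
    using assms(2)
    by (intro sum.cong refl) (simp add: unitary_on_def flip: sum_distrib_right)
  also have "\<dots> = (\<Sum>y\<in>B. \<Sum>z\<in>B. if z = y then \<psi> y * cnj (\<psi> z) else 0)"
    by (intro sum.cong refl) simp
  also have "\<dots> = (\<Sum>y\<in>B. \<psi> y * cnj (\<psi> y))"
    using assms(1) by simp
  also have "\<dots> = complex_of_real (\<Sum>y\<in>B. (cmod (\<psi> y))\<^sup>2)"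
    by (simp only: of_real_sum complex_norm_square)
  finally have "(\<Sum>x\<in>B. (cmod (apply_op B U \<psi> x))\<^sup>2) = (\<Sum>y\<in>B. (cmod (\<psi> y))\<^sup>2)"
    by (simp only: of_real_eq_iff)
  then show ?thesis
    by (simp add: amp_norm_def L2_set_def)
qed

lemma apply_op_diff:
  "apply_op B U \<psi> x - apply_op B U \<phi> x = apply_op B U (\<lambda>y. \<psi> y - \<phi> y) x"
  by (simp add: apply_op_def sum_subtractf algebra_simps)

lemma amp_norm_unitary_diff:
  assumes "finite B" "unitary_on B U"
  shows "amp_norm B (\<lambda>x. apply_op B U \<psi> x - apply_op B U \<phi> x) = amp_norm B (\<lambda>x. \<psi> x - \<phi> x)"
  by (simp only: apply_op_diff amp_norm_apply_unitary[OF assms])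

section \<open>Distance between the states for two inputs\<close>

lemma finite_labels: "finite (labels n b w)"
  by (simp add: labels_def)

text \<open>The matrix is that of a self-inverse permutation, so row \<open>x\<close> has its only 1
  in column \<open>oracle_label s x\<close>, which is again a basis label.\<close>

lemma apply_oracle_op:
  assumes "length s = n" "set s \<subseteq> {0..<2 ^ b}" "x \<in> labels n b w"
  shows "apply_op (labels n b w) (oracle_op s) \<psi> x = \<psi> (oracle_label s x)"
proof -
  have "apply_op (labels n b w) (oracle_op s) \<psi> x
      = (\<Sum>y\<in>labels n b w. if y = oracle_label s x then \<psi> y else 0)"
    unfolding apply_op_def oracle_op_def
    by (rule sum.cong) (auto simp: oracle_label_involution)
  then show ?thesis
    using oracle_label_in_labels[OF assms] by (simp add: finite_labels)
qed

text \<open>The squared norm of a unit state on this set is the query weight of position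
  \<open>j\<close>.\<close>

definition query_part :: "nat \<Rightarrow> label set \<Rightarrow> label set" where
  "query_part j B = {x \<in> B. fst x = j}"

lemma amp_norm_oracle_query_part:
  assumes "length s = n" "set s \<subseteq> {0..<2 ^ b}"
  shows "amp_norm (query_part j (labels n b w)) (\<lambda>x. \<psi> (oracle_label s x))
       = amp_norm (query_part j (labels n b w)) \<psi>"
proof -
  have mem: "oracle_label s x \<in> query_part j (labels n b w)"
    if "x \<in> query_part j (labels n b w)" for x
    using that oracle_label_in_labels[OF assms, of x w]
    by (cases x) (simp add: query_part_def oracle_label_def)
  have "(\<Sum>x\<in>query_part j (labels n b w). (cmod (\<psi> (oracle_label s x)))\<^sup>2)
      = (\<Sum>x\<in>query_part j (labels n b w). (cmod (\<psi> x))\<^sup>2)"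
    by (rule sum.reindex_bij_witness[of _ "oracle_label s" "oracle_label s"])
      (simp_all add: mem oracle_label_involution)
  then show ?thesis
    by (simp add: amp_norm_def L2_set_def)
qed

text \<open>Both oracles act alike on labels with index other than \<open>j\<close>, so these
  cancel. On the rest each oracle preserves the norm, hence the factor 2.\<close>

lemma amp_norm_oracle_diff:
  fixes w :: nat
  assumes s: "length s = n" "set s \<subseteq> {0..<2 ^ b}"
    and t: "length t = n" "set t \<subseteq> {0..<2 ^ b}"
    and eq: "\<And>i. i \<in> {1..n} \<Longrightarrow> i \<noteq> j \<Longrightarrow> char_at t i = char_at s i"
  defines "B \<equiv> labels n b w"
  shows "amp_norm B (\<lambda>x. apply_op B (oracle_op s) \<psi> x - apply_op B (oracle_op t) \<psi> x)
       \<le> 2 * amp_norm (query_part j B) \<psi>"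
proof -
  let ?Q = "query_part j B"
  let ?d = "\<lambda>x. \<psi> (oracle_label s x) - \<psi> (oracle_label t x)"
  have fin: "finite B" and sub: "?Q \<subseteq> B"
    by (auto simp: B_def finite_labels query_part_def)
  have zero: "?d x = 0" if "x \<in> B - ?Q" for x
    using that eq by (cases x) (auto simp: B_def query_part_def oracle_label_def labels_def)
  have "amp_norm B (\<lambda>x. apply_op B (oracle_op s) \<psi> x - apply_op B (oracle_op t) \<psi> x)
      = amp_norm B ?d"
    by (rule amp_norm_cong) (simp add: B_def apply_oracle_op s t)
  also have "\<dots> = amp_norm ?Q ?d"
    unfolding amp_norm_def L2_set_def
    using zero by (intro arg_cong[of _ _ sqrt] sum.mono_neutral_right fin sub) simp
  also have "\<dots> \<le> amp_norm ?Q (\<lambda>x. \<psi> (oracle_label s x)) + amp_norm ?Q (\<lambda>x. \<psi> (oracle_label t x))"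
    by (rule amp_norm_triangle) (rule norm_triangle_ineq4)
  also have "\<dots> = 2 * amp_norm ?Q \<psi>"
    unfolding B_def by (simp add: amp_norm_oracle_query_part s t)
  finally show ?thesis .
qed

text \<open>Query parts for distinct \<open>j\<close> are disjoint, so Pythagoras applies.\<close>

lemma L2_set_query_part_le:
  assumes "finite B" "finite J"
  shows "L2_set (\<lambda>j. amp_norm (query_part j B) \<psi>) J \<le> amp_norm B \<psi>"
proof -
  have "(\<Sum>j\<in>J. (amp_norm (query_part j B) \<psi>)\<^sup>2)
      = (\<Sum>j\<in>J. \<Sum>x\<in>{x \<in> {x \<in> B. fst x \<in> J}. fst x = j}. (cmod (\<psi> x))\<^sup>2)"
    unfolding amp_norm_power2 query_part_def by (intro sum.cong) auto
  also have "\<dots> = (\<Sum>x\<in>{x \<in> B. fst x \<in> J}. (cmod (\<psi> x))\<^sup>2)"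
    using assms by (intro sum.group) auto
  also have "\<dots> \<le> (\<Sum>x\<in>B. (cmod (\<psi> x))\<^sup>2)"
    using assms by (intro sum_mono2) auto
  finally show ?thesis
    by (simp add: L2_set_def amp_norm_def)
qed

section \<open>The hybrid argument\<close>

locale query_run =
  fixes n :: nat and alphabet :: "nat set" and A :: query_algorithm
  assumes valid: "valid_algorithm n alphabet A" and n_pos: "n \<ge> 1"
begin

abbreviation B :: "label set" where
  "B \<equiv> alg_labels n A"

definition input :: "nat list \<Rightarrow> bool" where
  "input s \<longleftrightarrow> length s = n \<and> set s \<subseteq> alphabet"

lemma finite_B: "finite B"
  by (simp add: alg_labels_def finite_labels)

lemma inputD: "input s \<Longrightarrow> length s = n" "input s \<Longrightarrow> set s \<subseteq> {0..<2 ^ char_bits A}"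
  using valid by (auto simp: input_def valid_algorithm_def)

lemma unitary_gate: "k \<le> queries A \<Longrightarrow> unitary_on B (gate A k)"
  using valid by (simp add: valid_algorithm_def)

lemma unitary_oracle: "input s \<Longrightarrow> unitary_on B (oracle_op s)"
  by (simp add: alg_labels_def unitary_on_oracle_op inputD)

lemma amp_norm_state:
  assumes "input s" "k \<le> queries A"
  shows "amp_norm B (state_after n A s k) = 1"
  using assms(2)
proof (induction k)
  case 0
  have "(1, 0, 0) \<in> B"
    using valid n_pos by (simp add: alg_labels_def labels_def valid_algorithm_def)
  moreover have "(cmod (if x = (1, 0, 0) then 1 else 0))\<^sup>2 = (if x = (1, 0, 0) then 1 else 0)"
    for x :: label
    by simp
  ultimately have "amp_norm B (\<lambda>x. if x = (1, 0, 0) then 1 else 0) = 1"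
    using finite_B by (simp add: amp_norm_def L2_set_def)
  then show ?case
    by (simp add: amp_norm_apply_unitary finite_B unitary_gate)
next
  case (Suc k)
  then show ?case
    by (simp add: amp_norm_apply_unitary finite_B unitary_gate unitary_oracle assms(1))
qed

definition state_dist :: "nat list \<Rightarrow> nat list \<Rightarrow> nat \<Rightarrow> real" where
  "state_dist s t k = amp_norm B (\<lambda>x. state_after n A s k x - state_after n A t k x)"

lemma state_dist_nonneg: "0 \<le> state_dist s t k"
  by (simp add: state_dist_def amp_norm_nonneg)

text \<open>The gate, being unitary, drops out. The error is charged to the run on \<open>s\<close>
  alone, which makes the query weights independent of \<open>t\<close>.\<close>

lemma state_dist_Suc:
  assumes st: "input s" "input t"
    and eq: "\<And>i. i \<in> {1..n} \<Longrightarrow> i \<noteq> j \<Longrightarrow> char_at t i = char_at s i"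
    and k: "Suc k \<le> queries A"
  shows "state_dist s t (Suc k)
       \<le> state_dist s t k + 2 * amp_norm (query_part j B) (state_after n A s k)"
proof -
  let ?\<psi> = "state_after n A s k" and ?\<phi> = "state_after n A t k"
  let ?S = "apply_op B (oracle_op s)" and ?T = "apply_op B (oracle_op t)"
  have "state_dist s t (Suc k) = amp_norm B (\<lambda>x. ?S ?\<psi> x - ?T ?\<phi> x)"
    by (simp add: state_dist_def amp_norm_unitary_diff finite_B unitary_gate k)
  \<comment> \<open>The hybrid is \<open>?T ?\<psi>\<close>: the first term changes only the state,
    the second only the oracle.\<close>
  also have "\<dots> \<le> amp_norm B (\<lambda>x. ?T ?\<psi> x - ?T ?\<phi> x) + amp_norm B (\<lambda>x. ?S ?\<psi> x - ?T ?\<psi> x)"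
    by (rule amp_norm_triangle, rule order.trans[OF eq_refl norm_triangle_ineq]) simp
  also have "amp_norm B (\<lambda>x. ?T ?\<psi> x - ?T ?\<phi> x) = state_dist s t k"
    by (simp add: state_dist_def amp_norm_unitary_diff finite_B unitary_oracle st)
  also have "amp_norm B (\<lambda>x. ?S ?\<psi> x - ?T ?\<psi> x) \<le> 2 * amp_norm (query_part j B) ?\<psi>"
    unfolding alg_labels_def using inputD st eq by (intro amp_norm_oracle_diff) auto
  finally show ?thesis by simp
qed

text \<open>All \<open>t j\<close> are compared with the same run on \<open>s\<close>, whose query
  weights sum to at most 1 at each query. By Minkowski over \<open>j\<close>, one more query costs
  at most 2.\<close>

lemma L2_set_state_dist_le:
  assumes J: "finite J" and s: "input s" and t: "\<And>j. j \<in> J \<Longrightarrow> input (t j)"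
    and eq: "\<And>i j. j \<in> J \<Longrightarrow> i \<in> {1..n} \<Longrightarrow> i \<noteq> j \<Longrightarrow> char_at (t j) i = char_at s i"
    and "k \<le> queries A"
  shows "L2_set (\<lambda>j. state_dist s (t j) k) J \<le> 2 * real k"
  using assms(5)
proof (induction k)
  case 0
  then show ?case
    by (simp add: state_dist_def amp_norm_def L2_set_def)
next
  case (Suc k)
  let ?q = "\<lambda>j. amp_norm (query_part j B) (state_after n A s k)"
  have "L2_set (\<lambda>j. state_dist s (t j) (Suc k)) J
      \<le> L2_set (\<lambda>j. state_dist s (t j) k + 2 * ?q j) J"
    using Suc.prems s t eq by (intro L2_set_mono state_dist_Suc state_dist_nonneg) auto
  also have "\<dots> \<le> L2_set (\<lambda>j. state_dist s (t j) k) J + L2_set (\<lambda>j. 2 * ?q j) J"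
    by (rule L2_set_triangle_ineq)
  also have "L2_set (\<lambda>j. 2 * ?q j) J = 2 * L2_set ?q J"
    by (simp add: L2_set_right_distrib)
  also have "L2_set ?q J \<le> 1"
    using L2_set_query_part_le[OF finite_B J, of "state_after n A s k"] amp_norm_state[OF s, of k]
      Suc.prems by simp
  also have "L2_set (\<lambda>j. state_dist s (t j) k) J \<le> 2 * real k"
    using Suc by simp
  finally show ?case by simp
qed

section \<open>Output probabilities and separation of final states\<close>

lemma output_prob_eq:
  "output_prob n A s v = (amp_norm {x \<in> B. answer A x = v} (state_after n A s (queries A)))\<^sup>2"
  by (simp add: output_prob_def amp_norm_power2)

lemma output_prob_add_le_1:
  assumes "input s" "u \<noteq> v"
  shows "output_prob n A s u + output_prob n A s v \<le> 1"
proof -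
  let ?p = "\<lambda>x. (cmod (state_after n A s (queries A) x))\<^sup>2"
  have "output_prob n A s u + output_prob n A s v
      = sum ?p ({x \<in> B. answer A x = u} \<union> {x \<in> B. answer A x = v})"
    unfolding output_prob_def using assms(2) finite_B by (subst sum.union_disjoint) auto
  also have "\<dots> \<le> sum ?p B"
    using finite_B by (intro sum_mono2) auto
  also have "\<dots> = 1"
    using amp_norm_state[OF assms(1) order_refl] by (simp flip: amp_norm_power2)
  finally show ?thesis .
qed

text \<open>On the labels answered by \<open>v\<close>, the norms of the two states are the roots of
  the two probabilities, and they differ by at most the distance of the states.\<close>

lemma state_dist_lower_bound:
  assumes "output_prob n A s v \<ge> 2 / 3" "output_prob n A t v \<le> 1 / 3"
  shows "state_dist s t (queries A) \<ge> 1 / 5"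
proof -
  let ?V = "{x \<in> B. answer A x = v}"
  define p where "p = amp_norm ?V (state_after n A s (queries A))"
  define q where "q = amp_norm ?V (state_after n A t (queries A))"
  define d where "d = state_dist s t (queries A)"
  have p: "p\<^sup>2 \<ge> 2 / 3" and q: "q\<^sup>2 \<le> 1 / 3" and nn: "p \<ge> 0" "q \<ge> 0"
    using assms by (simp_all add: p_def q_def output_prob_eq amp_norm_nonneg)
  have "p \<le> q + amp_norm ?V (\<lambda>x. state_after n A s (queries A) x - state_after n A t (queries A) x)"
    unfolding p_def q_def by (rule amp_norm_triangle) (rule norm_triangle_sub)
  also have "\<dots> \<le> q + d"
    unfolding d_def state_dist_def using finite_B by (intro add_left_mono amp_norm_mono) auto
  finally have pqd: "p \<le> q + d" .
  \<comment> \<open>Rational bounds for the roots: 1/3 \<le> 9/25 and 16/25 \<le> 2/3, leaving the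
    gap 1/5.\<close>
  have q': "q \<le> 3 / 5"
    by (rule power2_le_imp_le) (use q in \<open>simp_all add: power2_eq_square\<close>)
  have "4 / 5 \<le> p"
    by (rule power2_le_imp_le) (use p nn in \<open>simp_all add: power2_eq_square\<close>)
  then show ?thesis
    using pqd q' unfolding d_def by simp
qed

end

text \<open>\<open>J\<close> is a set of sensitive positions of an arbitrary \<open>f\<close> at
  \<open>s\<close>, each witnessed by \<open>t j\<close>. The factor 10 is the cost 2 per query
  divided by the distance 1/5.\<close>

theorem quantum_sensitivity_bound:
  assumes comp: "quantum_computes n alphabet A f" and "n \<ge> 1"
    and s: "length s = n" "set s \<subseteq> alphabet"
    and t: "\<And>j. j \<in> J \<Longrightarrow> length (t j) = n" "\<And>j. j \<in> J \<Longrightarrow> set (t j) \<subseteq> alphabet"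
    and eq: "\<And>i j. j \<in> J \<Longrightarrow> i \<in> {1..n} \<Longrightarrow> i \<noteq> j \<Longrightarrow> char_at (t j) i = char_at s i"
    and ne: "\<And>j. j \<in> J \<Longrightarrow> f (t j) \<noteq> f s"
    and J: "finite J"
  shows "sqrt (real (card J)) \<le> 10 * real (queries A)"
proof -
  interpret query_run n alphabet A
    using comp \<open>n \<ge> 1\<close> by unfold_locales (auto simp: quantum_computes_def)
  have in_s: "input s" and in_t: "\<And>j. j \<in> J \<Longrightarrow> input (t j)"
    using s t by (auto simp: input_def)
  have correct: "output_prob n A r (f r) \<ge> 2 / 3" if "input r" for r
    using comp that by (simp add: quantum_computes_def input_def)
  have "state_dist s (t j) (queries A) \<ge> 1 / 5" if "j \<in> J" for j
  proof (rule state_dist_lower_bound)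
    show "output_prob n A s (f s) \<ge> 2 / 3"
      using correct in_s .
    \<comment> \<open>The correct answer \<open>f (t j)\<close> differs from \<open>f s\<close> and
      already takes probability 2/3.\<close>
    show "output_prob n A (t j) (f s) \<le> 1 / 3"
      using output_prob_add_le_1[OF in_t[OF that] ne[OF that]] correct[OF in_t[OF that]] by simp
  qed
  then have "L2_set (\<lambda>j. 1 / 5) J \<le> L2_set (\<lambda>j. state_dist s (t j) (queries A)) J"
    by (intro L2_set_mono) auto
  also have "\<dots> \<le> 2 * real (queries A)"
    using J in_s in_t eq by (rule L2_set_state_dist_le) simp_all
  finally show ?thesis
    by (simp add: L2_set_constant J)
qed

section \<open>Squares in almost constant strings\<close>

lemma square_shifts_iff:
  "\<Delta> \<in> square_shifts s \<longleftrightarrow>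
     (\<exists>i. 1 \<le> i \<and> i + 2 * \<Delta> \<le> length s + 1 \<and>
       (\<forall>k\<in>{i..<i + \<Delta>}. char_at s k = char_at s (k + \<Delta>)))"
proof -
  have "[i + \<Delta>..<i + 2 * \<Delta>] = map (\<lambda>k. k + \<Delta>) [i..<i + \<Delta>]" for i
    by (rule nth_equalityI) auto
  then show ?thesis
    by (simp add: square_shifts_def substring_def)
qed

lemma longest_square_replicate: "longest_square (replicate n a) = n div 2"
  unfolding longest_square_def
proof (rule Max_eqI[OF finite_square_shifts])
  show "\<Delta> \<le> n div 2" if "\<Delta> \<in> square_shifts (replicate n a)" for \<Delta>
    using that by (auto simp: square_shifts_iff)
  show "n div 2 \<in> square_shifts (replicate n a)"
    unfolding square_shifts_iff by (intro exI[of _ 1]) (auto simp: char_at_def)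
qed

text \<open>\<open>1 \<le> j\<close> keeps \<open>j - 1\<close> from truncating:
  \<open>j = 0\<close> would overwrite position 1.\<close>

lemma char_at_replicate_update:
  assumes "i \<in> {1..n}" "1 \<le> j"
  shows "char_at ((replicate n a)[j - 1 := b]) i = (if i = j then b else a)"
  using assms by (auto simp: char_at_def nth_list_update)

lemma longest_square_replicate_update:
  assumes "a \<noteq> b" "1 < j" "j < n"
  shows "longest_square ((replicate n a)[j - 1 := b]) \<noteq> n div 2"
proof
  let ?s = "(replicate n a)[j - 1 := b]" and ?m = "n div 2"
  assume "longest_square ?s = ?m"
  then have "?m \<in> square_shifts ?s"
    using Max_in[OF finite_square_shifts, of ?s] zero_in_square_shifts[of ?s]
    by (auto simp: longest_square_def)
  then obtain i where i: "1 \<le> i" "i + 2 * ?m \<le> n + 1"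
    and eq: "\<And>k. k \<in> {i..<i + ?m} \<Longrightarrow> char_at ?s k = char_at ?s (k + ?m)"
    by (auto simp: square_shifts_iff)
  \<comment> \<open>The square misses at most one position, so \<open>i \<le> 2 \<le> j\<close> and
    \<open>j < n \<le> i + 2 * ?m\<close>: it covers \<open>j\<close>.\<close>
  have m: "?m \<ge> 1" "n \<le> 2 * ?m + 1" and le: "i \<le> j" "j < i + 2 * ?m"
    using i assms by linarith+
  \<comment> \<open>The comparison of \<open>k\<close> with \<open>k + ?m\<close> is the one
    involving \<open>j\<close>. As \<open>?m\<close> is positive, exactly one of the two positions
    is \<open>j\<close>.\<close>
  define k where "k = (if j < i + ?m then j else j - ?m)"
  have k: "k \<in> {i..<i + ?m}" "(k = j) \<noteq> (k + ?m = j)"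
    using le m by (auto simp: k_def)
  have pos: "k \<in> {1..n}" "k + ?m \<in> {1..n}"
    using i k(1) by auto
  have "1 \<le> j"
    using assms by simp
  then show False
    using eq[OF k(1)] k(2) assms(1)
    by (simp only: char_at_replicate_update pos split: if_splits)
qed

theorem proposition5p2:
  shows "\<exists>C::real. C > 0 \<and> (\<exists>N::nat. \<forall>n\<ge>N. \<forall>(alphabet::nat set) (A::query_algorithm).
           finite alphabet \<and> card alphabet \<ge> 2 \<and> quantum_computes n alphabet A longest_square
             \<longrightarrow> real (queries A) \<ge> C * sqrt (real n))"
\<comment> \<open>The sensitivity bound contributes 10, and passing from the interior positions to
  all \<open>n\<close> another 2.\<close>
proof (intro exI[of _ "1 / 20"] conjI exI[of _ 4] allI impI)
  fix n :: nat and alphabet :: "nat set" and A :: query_algorithm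
  assume n: "n \<ge> 4"
    and "finite alphabet \<and> card alphabet \<ge> 2 \<and> quantum_computes n alphabet A longest_square"
  then have comp: "quantum_computes n alphabet A longest_square" and "2 \<le> card alphabet"
    by auto
  then obtain S where "S \<subseteq> alphabet" "card S = 2"
    by (elim obtain_subset_with_card_n)
  then obtain a b where ab: "a \<in> alphabet" "b \<in> alphabet" "a \<noteq> b"
    by (auto simp: card_2_iff)
  let ?t = "\<lambda>j. (replicate n a)[j - 1 := b]"
  have "sqrt (real (card {1<..<n})) \<le> 10 * real (queries A)"
  proof (rule quantum_sensitivity_bound[OF comp, where s = "replicate n a" and t = ?t])
    show "set (replicate n a) \<subseteq> alphabet"
      using ab by auto
    show "set (?t j) \<subseteq> alphabet" for j
      using ab set_update_subset_insert[of "replicate n a" "j - 1" b] by auto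
    show "char_at (?t j) i = char_at (replicate n a) i"
      if "j \<in> {1<..<n}" "i \<in> {1..n}" "i \<noteq> j" for i j
      using that by (subst char_at_replicate_update) (auto simp: char_at_def)
    show "longest_square (?t j) \<noteq> longest_square (replicate n a)" if "j \<in> {1<..<n}" for j
      using that ab by (simp add: longest_square_replicate longest_square_replicate_update
          del: One_nat_def)
  qed (use n in auto)
  \<comment> \<open>There are \<open>n - 2\<close> interior positions, and
    \<open>n \<le> 4 * (n - 2)\<close> by \<open>n \<ge> 4\<close>.\<close>
  moreover have "sqrt (real n) \<le> 2 * sqrt (real (card {1<..<n}))"
    using n by (intro real_le_lsqrt) (auto simp: power_mult_distrib of_nat_diff)
  ultimately show "1 / 20 * sqrt (real n) \<le> real (queries A)"
    by simp
qed simp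

end
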